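(* Let $\mathfrak{g}$ be a finite-dimensional semisimple complex Lie algebra and let $N\ge3$ be an integer. Then every $N$-derivation of $\mathfrak{g}$ is an inner derivation, i.e. equals $\mathrm{ad}\,x$ for some $x\in\mathfrak{g}$.
   Context: For elements of a Lie algebra $\mathfrak{g}$ write $[x_1,\dots,x_N]=[x_1,[x_2,\cdots[x_{N-2},[x_{N-1},x_N]]\cdots]]$. An $N$-derivation of $\mathfrak{g}$ is a linear map $\varphi:\mathfrak{g}\to\mathfrak{g}$ with $\varphi([x_1,\dots,x_N])=\sum_{i=1}^N[x_1,\dots,x_{i-1},\varphi(x_i),x_{i+1},\dots,x_N]$ for all $x_1,\dots,x_N\in\mathfrak{g}$. *)

theory Defs
  imports Complex_Main
begin

locale lie_algebra = vector_space scale
  for scale :: "'k::field \<Rightarrow> 'a::ab_group_add \<Rightarrow> 'a" +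
  fixes bracket :: "'a \<Rightarrow> 'a \<Rightarrow> 'a"
  assumes bracket_add_left: "bracket (x + y) z = bracket x z + bracket y z"
    and bracket_add_right: "bracket x (y + z) = bracket x y + bracket x z"
    and bracket_scale_left: "bracket (scale c x) y = scale c (bracket x y)"
    and bracket_scale_right: "bracket x (scale c y) = scale c (bracket x y)"
    and bracket_self: "bracket x x = 0"
    and jacobi: "bracket x (bracket y z) + bracket y (bracket z x) + bracket z (bracket x y) = 0"
begin

definition ad :: "'a \<Rightarrow> 'a \<Rightarrow> 'a" where
  "ad x = (\<lambda>y. bracket x y)"

definition lie_ideal :: "'a set \<Rightarrow> bool" where
  "lie_ideal I \<longleftrightarrow> subspace I \<and> (\<forall>x. \<forall>y\<in>I. bracket x y \<in> I)"

definition derived :: "'a set \<Rightarrow> 'a set" where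
  "derived S = span {bracket x y |x y. x \<in> S \<and> y \<in> S}"

definition solvable :: "'a set \<Rightarrow> bool" where
  "solvable S \<longleftrightarrow> (\<exists>n. (derived ^^ n) S = {0})"

text \<open>Semisimple means that the radical vanishes, that is, there is no nonzero solvable ideal.
  The zero algebra counts as semisimple.\<close>

definition semisimple :: bool where
  "semisimple \<longleftrightarrow> (\<forall>I. lie_ideal I \<and> solvable I \<longrightarrow> I = {0})"

text \<open>Right-nested brackets; the value on the empty list is a dummy.\<close>

fun nested_bracket :: "'a list \<Rightarrow> 'a" where
  "nested_bracket [] = 0"
| "nested_bracket [x] = x"
| "nested_bracket (x # y # ys) = bracket x (nested_bracket (y # ys))"

definition N_derivation :: "nat \<Rightarrow> ('a \<Rightarrow> 'a) \<Rightarrow> bool" where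
  "N_derivation N \<phi> \<longleftrightarrow> Vector_Spaces.linear scale scale \<phi> \<and>
     (\<forall>xs. length xs = N \<longrightarrow>
        \<phi> (nested_bracket xs) = (\<Sum>i<N. nested_bracket (xs[i := \<phi> (xs ! i)])))"

end

end

theory Submission
  imports Defs "HOL-Computational_Algebra.Fundamental_Theorem_Algebra"
begin

text \<open>The Killing form of a semisimple Lie algebra is nondegenerate: if \<open>x\<close> is a sum of brackets of
  elements of its radical, then the map \<open>Y\<close> acting as the conjugate of \<open>a\<close> on the generalised
  \<open>a\<close>-eigenspace of \<open>ad x\<close> is a derivation, whence \<open>tr (ad x \<circ> Y) = 0\<close> by invariance of the form.
  That trace is the sum of the \<open>\<bar>a\<bar>\<^sup>2\<close>, so \<open>ad x\<close> is nilpotent, and Engel's theorem makes the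
  radical solvable, hence zero. Nondegeneracy yields that derivations are inner and that the
  algebra is spanned by \<open>m\<close>-fold brackets for every \<open>m\<close>.

  An \<open>N\<close>-derivation \<open>\<phi>\<close> satisfies \<open>[\<phi>, ad x\<^sub>1 \<cdots> ad x\<^sub>M] = \<Sum>\<^sub>i ad x\<^sub>1 \<cdots> ad (\<phi> x\<^sub>i) \<cdots> ad x\<^sub>M\<close> with
  \<open>M = N - 1\<close>. Passing to iterated commutators of the \<open>ad x\<^sub>i\<close>, one finds that \<open>\<phi>\<close> normalises
  \<open>ad g\<close>, so it induces a derivation, which is inner, say \<open>ad w\<close>. Then \<open>\<chi> = \<phi> - ad w\<close> commutes
  with \<open>ad g\<close>, and comparing both sides of the defining identity gives \<open>(N - 1) \<chi> = 0\<close>.\<close>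

section \<open>Traces\<close>

text \<open>A separate locale, because an abbreviation \<open>endo\<close> in the library locale is captured by its
  global interpretation \<open>real_vector\<close>.\<close>

locale fdvs = finite_dimensional_vector_space scale Basis
  for scale :: "'a::field \<Rightarrow> 'b::ab_group_add \<Rightarrow> 'b" and Basis :: "'b set"
begin

abbreviation endo :: "('b \<Rightarrow> 'b) \<Rightarrow> bool" where
  "endo \<equiv> Vector_Spaces.linear scale scale"

lemma endoI:
  assumes "\<And>x y. f (x + y) = f x + f y" and "\<And>c x. f (scale c x) = scale c (f x)"
  shows "endo f"
  using assms vector_space_axioms by (simp add: Vector_Spaces.linear_iff)

lemma endo_add: "endo f \<Longrightarrow> f (x + y) = f x + f y"
  and endo_scale: "endo f \<Longrightarrow> f (scale c x) = scale c (f x)"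
  by (simp_all add: Vector_Spaces.linear_iff)

lemma endo_zero: "endo f \<Longrightarrow> f 0 = 0"
  using endo_scale[of f 0 0] by simp

lemma endo_minus: "endo f \<Longrightarrow> f (- x) = - f x"
  using endo_add[of f x "- x"] endo_zero[of f] by (simp add: eq_neg_iff_add_eq_0 add.commute)

lemma endo_diff: "endo f \<Longrightarrow> f (x - y) = f x - f y"
  using endo_add[of f x "- y"] endo_minus[of f y] by simp

lemma endo_sum:
  assumes "endo f"
  shows "f (sum g A) = (\<Sum>a\<in>A. f (g a))"
  by (induction A rule: infinite_finite_induct) (use assms in \<open>auto simp: endo_add endo_zero\<close>)

lemma endo_compose: "endo f \<Longrightarrow> endo g \<Longrightarrow> endo (\<lambda>x. f (g x))"
  by (intro endoI) (simp_all add: endo_add endo_scale)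

lemma endo_sub: "endo f \<Longrightarrow> endo g \<Longrightarrow> endo (\<lambda>x. f x - g x)"
  by (intro endoI) (simp_all add: endo_add endo_scale scale_right_diff_distrib)

lemma subspace_kernel_endo: "endo f \<Longrightarrow> subspace {x. f x = 0}"
  by (intro subspaceI) (simp_all add: endo_add endo_scale endo_zero)

text \<open>Both sides are the same double sum over products of matrix entries, summed in the two
  orders. Allowing different bases yields cyclicity of the trace and, for \<open>g\<close> the
  identity, its independence of the basis.\<close>

lemma trace_comm_two_bases:
  assumes B: "finite B" "independent B" "span B = UNIV"
    and C: "finite C" "independent C" "span C = UNIV"
    and f: "endo f" and g: "endo g"
  shows "(\<Sum>b\<in>B. representation B (f (g b)) b) = (\<Sum>c\<in>C. representation C (g (f c)) c)"
proof -
  have expand: "representation B (f (g x)) y = (\<Sum>c\<in>C. representation C (g x) c * representation B (f c) y)"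
    if B: "finite B" "independent B" "span B = UNIV"
      and C: "finite C" "independent C" "span C = UNIV"
      and f: "endo f" for B C f g x y
  proof -
    have "f (g x) = f (\<Sum>c\<in>C. scale (representation C (g x) c) c)"
      using sum_representation_eq[OF C(2) _ C(1) order_refl, of "g x"] C(3) by simp
    also have "\<dots> = (\<Sum>c\<in>C. scale (representation C (g x) c) (f c))"
      by (simp add: endo_sum[OF f] endo_scale[OF f])
    finally show ?thesis
      using B by (simp add: representation_sum representation_scale)
  qed
  have "(\<Sum>b\<in>B. representation B (f (g b)) b)
      = (\<Sum>b\<in>B. \<Sum>c\<in>C. representation C (g b) c * representation B (f c) b)"
    by (simp add: expand[OF B C f])
  also have "\<dots> = (\<Sum>c\<in>C. \<Sum>b\<in>B. representation B (f c) b * representation C (g b) c)"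
    by (subst sum.swap) (simp add: mult.commute)
  finally show ?thesis
    by (simp add: expand[OF C B g])
qed

definition trace :: "('b \<Rightarrow> 'b) \<Rightarrow> 'a" where
  "trace f = (\<Sum>b\<in>Basis. representation Basis (f b) b)"

lemma trace_comm: "endo f \<Longrightarrow> endo g \<Longrightarrow> trace (\<lambda>x. f (g x)) = trace (\<lambda>x. g (f x))"
  unfolding trace_def
  by (rule trace_comm_two_bases) (simp_all add: finite_Basis independent_Basis span_Basis)

lemma trace_any_basis:
  assumes "finite B" "independent B" "span B = UNIV" "endo f"
  shows "trace f = (\<Sum>b\<in>B. representation B (f b) b)"
  unfolding trace_def
  using trace_comm_two_bases[of Basis B f "\<lambda>x. x"] assms
  by (simp add: finite_Basis independent_Basis span_Basis endoI)

lemma trace_add: "trace (\<lambda>x. f x + g x) = trace f + trace g"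
  by (simp add: trace_def representation_add independent_Basis span_Basis sum.distrib)

lemma trace_diff: "trace (\<lambda>x. f x - g x) = trace f - trace g"
  by (simp add: trace_def representation_diff independent_Basis span_Basis sum_subtractf)

lemma trace_scale: "trace (\<lambda>x. scale c (f x)) = c * trace f"
  by (simp add: trace_def representation_scale independent_Basis span_Basis sum_distrib_left)

lemma trace_zero: "trace (\<lambda>x. 0) = 0"
  by (simp add: trace_def representation_zero)

section \<open>Generalised eigenspaces\<close>

definition shift :: "('b \<Rightarrow> 'b) \<Rightarrow> 'a \<Rightarrow> 'b \<Rightarrow> 'b" where
  "shift T a v = T v - scale a v"

text \<open>Meaningful for every scalar \<open>a\<close>: the space is zero when \<open>a\<close> is
  no eigenvalue, so no spectrum has to be fixed.\<close>

definition gen_eigenspace :: "('b \<Rightarrow> 'b) \<Rightarrow> 'a \<Rightarrow> 'b set" where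
  "gen_eigenspace T a = {v. \<exists>n. (shift T a ^^ n) v = 0}"

lemma endo_shift: "endo T \<Longrightarrow> endo (shift T a)"
  by (intro endoI) (simp_all add: shift_def endo_add endo_scale algebra_simps)

lemma endo_funpow: "endo T \<Longrightarrow> endo (T ^^ n)"
  by (induction n) (simp_all add: endoI endo_add endo_scale)

lemma funpow_zero_mono:
  assumes "endo T" "(T ^^ m) v = 0" "m \<le> n"
  shows "(T ^^ n) v = 0"
proof -
  have "(T ^^ n) v = (T ^^ (n - m)) ((T ^^ m) v)"
    using assms(3) by (metis comp_apply funpow_add le_add_diff_inverse2)
  then show ?thesis
    using assms by (simp add: endo_zero[OF endo_funpow])
qed

lemma subspace_gen_eigenspace:
  assumes "endo T"
  shows "subspace (gen_eigenspace T a)"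
proof (rule subspaceI)
  have E: "endo (shift T a)" "endo (shift T a ^^ n)" for n
    using assms endo_shift endo_funpow by auto
  show "0 \<in> gen_eigenspace T a"
    using E(2)[THEN endo_zero] by (auto simp: gen_eigenspace_def)
  show "x + y \<in> gen_eigenspace T a" if "x \<in> gen_eigenspace T a" "y \<in> gen_eigenspace T a" for x y
  proof -
    from that obtain m n where mn: "(shift T a ^^ m) x = 0" "(shift T a ^^ n) y = 0"
      by (auto simp: gen_eigenspace_def)
    have "(shift T a ^^ max m n) (x + y) = 0"
      using funpow_zero_mono[OF E(1) mn(1), of "max m n"] funpow_zero_mono[OF E(1) mn(2), of "max m n"]
      by (simp add: endo_add[OF E(2)])
    then show ?thesis
      by (auto simp: gen_eigenspace_def)
  qed
  show "scale c x \<in> gen_eigenspace T a" if "x \<in> gen_eigenspace T a" for c x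
    using that endo_scale[OF E(2)] by (fastforce simp: gen_eigenspace_def)
qed

lemma gen_eigenspace_shift_iff:
  assumes "endo T"
  shows "shift T a v \<in> gen_eigenspace T a \<longleftrightarrow> v \<in> gen_eigenspace T a"
proof
  assume "shift T a v \<in> gen_eigenspace T a"
  then obtain n where "(shift T a ^^ n) (shift T a v) = 0"
    by (auto simp: gen_eigenspace_def)
  then have "(shift T a ^^ Suc n) v = 0"
    by (simp add: funpow_swap1)
  then show "v \<in> gen_eigenspace T a"
    by (auto simp: gen_eigenspace_def simp del: funpow.simps)
next
  assume "v \<in> gen_eigenspace T a"
  then obtain n where "(shift T a ^^ n) v = 0"
    by (auto simp: gen_eigenspace_def)
  then have "(shift T a ^^ n) (shift T a v) = 0"
    using endo_zero[OF endo_shift[OF assms]] by (simp add: funpow_swap1[symmetric])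
  then show "shift T a v \<in> gen_eigenspace T a"
    by (auto simp: gen_eigenspace_def)
qed

lemma gen_eigenspace_invariant:
  assumes "endo T" "v \<in> gen_eigenspace T a"
  shows "T v \<in> gen_eigenspace T a"
proof -
  have "shift T a v + scale a v \<in> gen_eigenspace T a"
    using assms by (intro subspace_add subspace_scale subspace_gen_eigenspace)
      (simp_all add: gen_eigenspace_shift_iff)
  then show ?thesis
    by (simp add: shift_def)
qed

lemma gen_eigenspace_shift_invariant:
  assumes "endo T" "v \<in> gen_eigenspace T b"
  shows "shift T a v \<in> gen_eigenspace T b"
  unfolding shift_def
  using assms by (intro subspace_diff subspace_scale subspace_gen_eigenspace gen_eigenspace_invariant)

text \<open>On the generalised \<open>b\<close>-eigenspace, \<open>T - a\<close> is a nonzero scalar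
  plus a locally nilpotent map. The preimage is built by induction on the power of
  \<open>T - b\<close> that kills \<open>u\<close>.\<close>

lemma shift_surj_gen_eigenspace:
  assumes "endo T" "a \<noteq> b" "u \<in> gen_eigenspace T b"
  shows "\<exists>w\<in>gen_eigenspace T b. shift T a w = u"
proof -
  have "(shift T b ^^ m) u = 0 \<Longrightarrow> u \<in> gen_eigenspace T b
      \<Longrightarrow> \<exists>w\<in>gen_eigenspace T b. shift T a w = u" for m
  proof (induction m arbitrary: u)
    case 0
    then show ?case
      using endo_zero[OF endo_shift[OF assms(1)]] by auto
  next
    case (Suc m)
    have "(shift T b ^^ m) (shift T b u) = 0"
      using Suc.prems(1) by (simp add: funpow_swap1)
    then obtain w where w: "w \<in> gen_eigenspace T b" "shift T a w = shift T b u"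
      using Suc.IH gen_eigenspace_shift_iff[OF assms(1)] Suc.prems(2) by blast
    \<comment> \<open>Since \<open>(T - a) u = (T - b) u + (b - a) u\<close> and \<open>w\<close>
      accounts for the first summand, \<open>u - w\<close> is sent to
      \<open>(b - a) u\<close>.\<close>
    have "shift T a (scale (1 / (b - a)) (u - w)) = scale (1 / (b - a)) (shift T a u - shift T a w)"
      by (simp add: endo_scale[OF endo_shift[OF assms(1)]] endo_diff[OF endo_shift[OF assms(1)]])
    also have "\<dots> = scale (1 / (b - a)) (scale (b - a) u)"
      using w(2) by (simp add: shift_def scale_left_diff_distrib)
    also have "\<dots> = u"
      using assms(2) by simp
    finally show ?case
      using w(1) Suc.prems(2) subspace_gen_eigenspace[OF assms(1)]
      by (meson subspace_diff subspace_scale)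
  qed
  with assms(3) show ?thesis
    by (auto simp: gen_eigenspace_def)
qed

text \<open>On the kernel of \<open>T - a\<close>, the map \<open>T - b\<close> is the nonzero
  scalar \<open>a - b\<close>, and no power of that kills a nonzero vector.\<close>

lemma shift_inj_gen_eigenspace:
  assumes "endo T" "a \<noteq> b" "u \<in> gen_eigenspace T b" "shift T a u = 0"
  shows "u = 0"
proof -
  have step: "shift T b u = scale (a - b) u"
    using assms(4) by (simp add: shift_def scale_left_diff_distrib)
  have "(shift T b ^^ m) u = scale ((a - b) ^ m) u" for m
    by (induction m) (simp_all add: endo_scale[OF endo_shift[OF assms(1)]] step mult.commute)
  then show ?thesis
    using assms(2,3) by (auto simp: gen_eigenspace_def)
qed

lemma shift_funpow_inj_gen_eigenspace:
  assumes "endo T" "a \<noteq> b" "u \<in> gen_eigenspace T b" "(shift T a ^^ m) u = 0"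
  shows "u = 0"
  using assms(3,4)
proof (induction m arbitrary: u)
  case (Suc m)
  then have "shift T a u = 0"
    using gen_eigenspace_shift_invariant[OF assms(1)] by (simp add: funpow_swap1)
  then show ?case
    using shift_inj_gen_eigenspace[OF assms(1,2)] Suc.prems(1) by blast
qed simp

text \<open>A power of \<open>T - a\<close> that kills \<open>v a\<close> shortens the sum, and it
  is injective on the other generalised eigenspaces.\<close>

lemma gen_eigenspaces_independent:
  assumes "endo T" "finite F" "\<And>b. b \<in> F \<Longrightarrow> v b \<in> gen_eigenspace T b" "(\<Sum>b\<in>F. v b) = 0"
  shows "\<forall>b\<in>F. v b = 0"
  using assms(2-)
proof (induction F arbitrary: v rule: finite_induct)
  case (insert a F)
  obtain m where m: "(shift T a ^^ m) (v a) = 0"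
    using insert.prems(1)[of a] by (auto simp: gen_eigenspace_def)
  let ?S = "shift T a ^^ m"
  have E: "endo ?S"
    using assms(1) endo_shift endo_funpow by auto
  have inv: "u \<in> gen_eigenspace T b \<Longrightarrow> (shift T a ^^ k) u \<in> gen_eigenspace T b" for u b k
    by (induction k) (simp_all add: gen_eigenspace_shift_invariant[OF assms(1)])
  have "?S (\<Sum>b\<in>insert a F. v b) = 0"
    using insert.prems(2) endo_zero[OF E] by simp
  then have "(\<Sum>b\<in>F. ?S (v b)) = 0"
    using m insert.hyps by (simp add: endo_add[OF E] endo_sum[OF E])
  then have "\<forall>b\<in>F. ?S (v b) = 0"
    using insert.prems(1) by (intro insert.IH[of "\<lambda>b. ?S (v b)"] inv) simp_all
  then have F0: "\<forall>b\<in>F. v b = 0"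
    using shift_funpow_inj_gen_eigenspace[OF assms(1), of a] insert.prems(1) insert.hyps(2)
    by (metis insertI2)
  then show ?case
    using insert.prems(2) insert.hyps by simp
qed simp

text \<open>An orbit that starts outside \<open>U\<close> and later lies in \<open>U\<close> must
  enter it at some step. For \<open>f = T - a\<close> this produces an eigenvector modulo
  \<open>U\<close>.\<close>

lemma last_power_outside:
  assumes "(f ^^ m) v \<in> U" "v \<notin> U"
  shows "\<exists>k<m. (f ^^ k) v \<notin> U \<and> f ((f ^^ k) v) \<in> U"
  using assms
proof (induction m)
  case (Suc m)
  then show ?case
    by (cases "(f ^^ m) v \<in> U") (use less_Suc_eq in auto)
qed simp

end

section \<open>Spectral decomposition over the complex numbers\<close>

locale complex_fdvs = fdvs scale Basis
  for scale :: "complex \<Rightarrow> 'a::ab_group_add \<Rightarrow> 'a" and Basis :: "'a set"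
begin

definition poly_apply :: "complex poly \<Rightarrow> ('a \<Rightarrow> 'a) \<Rightarrow> 'a \<Rightarrow> 'a" where
  "poly_apply p T v = (\<Sum>i\<le>degree p. scale (coeff p i) ((T ^^ i) v))"

lemma poly_apply_bound:
  assumes "degree p \<le> n"
  shows "poly_apply p T v = (\<Sum>i\<le>n. scale (coeff p i) ((T ^^ i) v))"
  unfolding poly_apply_def
  by (rule sum.mono_neutral_left) (use assms in \<open>auto intro: coeff_eq_0\<close>)

lemma poly_apply_linear_factor:
  assumes "endo T"
  shows "poly_apply ([:- a, 1:] * q) T v = shift T a (poly_apply q T v)"
proof -
  let ?n = "degree q"
  let ?t = "\<lambda>i. (T ^^ i) v"
  have mult: "[:- a, 1:] * q = pCons 0 q - smult a q"
    by simp
  have "degree ([:- a, 1:] * q) \<le> Suc ?n"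
    by (rule order_trans[OF degree_mult_le]) simp
  then have "poly_apply ([:- a, 1:] * q) T v
      = (\<Sum>i\<le>Suc ?n. scale (coeff (pCons 0 q) i) (?t i)) - (\<Sum>i\<le>Suc ?n. scale (a * coeff q i) (?t i))"
    unfolding mult by (subst poly_apply_bound) (auto simp: scale_left_diff_distrib sum_subtractf simp del: sum.atMost_Suc)
  also have "(\<Sum>i\<le>Suc ?n. scale (coeff (pCons 0 q) i) (?t i)) = (\<Sum>i\<le>?n. scale (coeff q i) (?t (Suc i)))"
    by (subst sum.atMost_Suc_shift) simp
  also have "\<dots> = T (poly_apply q T v)"
    unfolding poly_apply_def by (simp add: endo_sum[OF assms] endo_scale[OF assms])
  also have "(\<Sum>i\<le>Suc ?n. scale (a * coeff q i) (?t i)) = scale a (poly_apply q T v)"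
    unfolding poly_apply_def by (simp add: coeff_eq_0 scale_sum_right)
  finally show ?thesis
    by (simp add: shift_def)
qed

text \<open>The vectors \<open>v, T v, T\<^sup>2 v, ...\<close> up to exponent
  \<open>dimension\<close> are too many to be independent. As dependence is a property of sets, a
  repetition among them is treated first, by a difference of two monomials.\<close>

lemma annihilating_poly: "\<exists>p. p \<noteq> 0 \<and> poly_apply p T v = 0"
proof (cases "inj_on (\<lambda>i. (T ^^ i) v) {..dimension}")
  case False
  then obtain i j where ij: "i \<noteq> j" "(T ^^ i) v = (T ^^ j) v"
    by (auto simp: inj_on_def)
  let ?p = "monom 1 i - monom 1 j :: complex poly"
  have "degree ?p \<le> max i j"
    by (rule degree_diff_le) (simp_all add: degree_monom_eq)
  then have "poly_apply ?p T v = (\<Sum>k\<le>max i j. scale (if i = k then 1 else 0) ((T ^^ k) v))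
      - (\<Sum>k\<le>max i j. scale (if j = k then 1 else 0) ((T ^^ k) v))"
    by (simp add: poly_apply_bound scale_left_diff_distrib sum_subtractf)
  also have "\<dots> = 0"
    using ij(2) by (simp add: if_distrib[of "\<lambda>c. scale c _"] sum.delta cong: if_cong)
  finally show ?thesis
    using ij(1) by (metis eq_iff_diff_eq_0 degree_monom_eq zero_neq_one)
next
  case True
  let ?f = "\<lambda>i. (T ^^ i) v" and ?n = dimension
  have "card (?f ` {..?n}) > dimension"
    using True by (simp add: card_image)
  then have "dependent (?f ` {..?n})"
    using independent_card_le_dim[of "?f ` {..?n}" UNIV] by (auto simp: dimension_def)
  then obtain u where u: "\<exists>w\<in>?f ` {..?n}. u w \<noteq> 0" "(\<Sum>w\<in>?f ` {..?n}. scale (u w) w) = 0"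
    by (auto simp: dependent_finite)
  define p where "p = Poly (map (\<lambda>i. u (?f i)) [0..<Suc ?n])"
  have cp: "coeff p i = (if i \<le> ?n then u (?f i) else 0)" for i
    by (auto simp: p_def nth_default_def simp del: upt_Suc)
  have "degree p \<le> ?n"
    by (rule degree_le) (simp add: cp)
  then have "poly_apply p T v = (\<Sum>i\<le>?n. scale (u (?f i)) (?f i))"
    by (simp add: poly_apply_bound cp)
  also have "\<dots> = 0"
    using u(2) True by (simp add: sum.reindex)
  finally have "poly_apply p T v = 0" .
  moreover have "p \<noteq> 0"
    using u(1) cp by (metis (no_types, lifting) atMost_iff coeff_0 imageE)
  ultimately show ?thesis
    by blast
qed

text \<open>Take \<open>p\<close> of least degree with \<open>p(T) w\<close> in \<open>U\<close> and
  split off a root \<open>a\<close>. The cofactor applied to \<open>w\<close> lies outside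
  \<open>U\<close> by minimality, and \<open>T - a\<close> moves it into \<open>U\<close>.\<close>

lemma eigenvector_modulo_subspace:
  assumes "endo T" "subspace U" "w \<notin> U"
  shows "\<exists>v a. v \<notin> U \<and> shift T a v \<in> U"
proof -
  let ?P = "\<lambda>p. p \<noteq> 0 \<and> poly_apply p T w \<in> U"
  have "\<exists>p. ?P p"
    using annihilating_poly[of T w] subspace_0[OF assms(2)] by auto
  then obtain p where p: "?P p" and min: "\<And>q. ?P q \<Longrightarrow> degree p \<le> degree q"
    using ex_has_least_nat[of ?P _ degree] by blast
  have "degree p \<noteq> 0"
  proof
    assume "degree p = 0"
    then obtain c where c: "p = [:c:]"
      by (auto elim: degree_eq_zeroE)
    then have "scale (inverse c) (scale c w) \<in> U"
      using p by (intro subspace_scale[OF assms(2), of "scale c w"]) (simp add: poly_apply_def)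
    moreover have "c \<noteq> 0"
      using c p by auto
    ultimately show False
      using assms(3) by simp
  qed
  then have "\<not> constant (poly p)"
    by (simp add: constant_degree)
  then obtain a where "poly p a = 0"
    using fundamental_theorem_of_algebra by blast
  then obtain q where q: "p = [:- a, 1:] * q"
    unfolding poly_eq_0_iff_dvd dvd_def by blast
  have "q \<noteq> 0"
    using p unfolding q by fastforce
  have "degree p = Suc (degree q)"
    unfolding q using \<open>q \<noteq> 0\<close> by (subst degree_mult_eq) (simp_all del: mult_pCons_left)
  then have "poly_apply q T w \<notin> U"
    using min[of q] \<open>q \<noteq> 0\<close> by linarith
  moreover have "shift T a (poly_apply q T w) \<in> U"
    using p unfolding q poly_apply_linear_factor[OF assms(1)] by blast
  ultimately show ?thesis
    by blast
qed

text \<open>If the span were proper, some \<open>v\<close> outside it would be an eigenvector modulo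
  the span, for some \<open>a\<close>. Correcting \<open>v\<close> by a suitable \<open>w\<close> in
  the span turns it into a generalised eigenvector, which lies in the span after all.\<close>

lemma span_gen_eigenspaces:
  assumes T: "endo T"
  shows "span (\<Union>a. gen_eigenspace T a) = UNIV"
proof (rule ccontr)
  let ?U = "span (\<Union>a. gen_eigenspace T a)"
  assume "?U \<noteq> UNIV"
  then obtain w where "w \<notin> ?U"
    by auto
  then obtain v a where v: "v \<notin> ?U" "shift T a v \<in> ?U"
    using eigenvector_modulo_subspace[OF T subspace_span] by blast
  \<comment> \<open>\<open>T - a\<close> is onto on each generalised eigenspace other than the one
    for \<open>a\<close>, so it reaches all of \<open>?U\<close> modulo that one.\<close>
  have "\<exists>w\<in>?U. u - shift T a w \<in> gen_eigenspace T a" if "u \<in> ?U" for u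
    using that
  proof (induction rule: span_induct_alt)
    case base
    show ?case
      using subspace_0[OF subspace_gen_eigenspace[OF T]]
      by (intro bexI[of _ 0]) (simp_all add: endo_zero[OF endo_shift[OF T]] span_zero)
  next
    case (step c x y)
    then obtain b w where b: "x \<in> gen_eigenspace T b"
      and w: "w \<in> ?U" "y - shift T a w \<in> gen_eigenspace T a"
      by auto
    note simps = endo_add[OF endo_shift[OF T]] endo_scale[OF endo_shift[OF T]]
    show ?case
    proof (cases "a = b")
      case True
      then have "scale c x + (y - shift T a w) \<in> gen_eigenspace T a"
        using b w subspace_gen_eigenspace[OF T] by (intro subspace_add subspace_scale) auto
      then show ?thesis
        using w(1) by (auto simp: add_diff_eq)
    next
      case False
      then obtain x' where x': "x' \<in> gen_eigenspace T b" "shift T a x' = x"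
        using shift_surj_gen_eigenspace[OF T False b] by blast
      then have "scale c x' + w \<in> ?U"
        using w(1) x'(1) by (intro span_add span_scale) (auto intro: span_base)
      moreover have "scale c x + y - shift T a (scale c x' + w) = y - shift T a w"
        by (simp add: simps x')
      ultimately show ?thesis
        using w(2) by metis
    qed
  qed
  then obtain w where w: "w \<in> ?U" "shift T a v - shift T a w \<in> gen_eigenspace T a"
    using v(2) by blast
  then have "v - w \<in> gen_eigenspace T a"
    by (simp add: gen_eigenspace_shift_iff[OF T] flip: endo_diff[OF endo_shift[OF T]])
  then have "(v - w) + w \<in> ?U"
    using w(1) by (intro span_add) (auto intro: span_base)
  then show False
    using v(1) by simp
qed

text \<open>A basis of generalised eigenvectors in which \<open>T\<close> is triangular. The order of the basis is
  left implicit, as only the diagonal entries matter for traces.\<close>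

lemma triangular_basis:
  assumes T: "endo T"
  obtains B \<alpha> where "finite B" "independent B" "span B = UNIV"
    "\<And>b. b \<in> B \<Longrightarrow> b \<in> gen_eigenspace T (\<alpha> b)"
    "\<And>b. b \<in> B \<Longrightarrow> representation B (T b) b = \<alpha> b"
proof -
  \<comment> \<open>A partial triangular basis with invariant span. One of maximal size exists
    because independent sets have at most \<open>dimension\<close> elements.\<close>
  define good where "good B \<longleftrightarrow> independent B \<and> T ` span B \<subseteq> span B \<and>
    (\<exists>\<alpha>. \<forall>b\<in>B. b \<in> gen_eigenspace T (\<alpha> b) \<and> representation B (T b) b = \<alpha> b)" for B
  have "good {}"
    using endo_zero[OF T] by (auto simp: good_def independent_empty)
  moreover have "\<And>B. good B \<Longrightarrow> card B \<le> dimension"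
    using independent_card_le_dim[of _ UNIV] by (auto simp: good_def dimension_def)
  ultimately obtain B where B: "good B" and max: "\<And>C. good C \<Longrightarrow> card C \<le> card B"
    using ex_has_greatest_nat[of good "{}" card "Suc dimension"] by (auto simp: less_Suc_eq_le)
  from B obtain \<alpha> where ind: "independent B" and inv: "T ` span B \<subseteq> span B"
    and \<alpha>: "\<And>b. b \<in> B \<Longrightarrow> b \<in> gen_eigenspace T (\<alpha> b)"
      "\<And>b. b \<in> B \<Longrightarrow> representation B (T b) b = \<alpha> b"
    unfolding good_def by blast
  have fin: "finite B"
    using ind finiteI_independent by blast
  have "span B = UNIV"
  proof (rule ccontr)
    assume "span B \<noteq> UNIV"
    then have "\<not> (\<Union>a. gen_eigenspace T a) \<subseteq> span B"
      using span_gen_eigenspaces[OF T] span_minimal[OF _ subspace_span] by blast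
    then obtain a w where w: "w \<in> gen_eigenspace T a" "w \<notin> span B"
      by blast
    then obtain m where "(shift T a ^^ m) w = 0"
      by (auto simp: gen_eigenspace_def)
    then have "(shift T a ^^ m) w \<in> span B"
      by (simp add: span_zero)
    from last_power_outside[OF this w(2)] obtain k where
      k: "(shift T a ^^ k) w \<notin> span B" "shift T a ((shift T a ^^ k) w) \<in> span B"
      by blast
    \<comment> \<open>This \<open>v\<close> is a generalised eigenvector with
      \<open>T v = a v\<close> modulo \<open>span B\<close>, so adding it keeps the span invariant
      and contributes the diagonal entry \<open>a\<close>.\<close>
    define v where "v = (shift T a ^^ k) w"
    have v: "v \<notin> span B" "shift T a v \<in> span B"
      using k by (auto simp: v_def)
    have "(shift T a ^^ i) w \<in> gen_eigenspace T a" for i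
      using w(1) by (induction i) (simp_all add: gen_eigenspace_shift_iff[OF T])
    then have va: "v \<in> gen_eigenspace T a"
      by (simp add: v_def)
    let ?C = "insert v B"
    have vB: "v \<notin> B"
      using v(1) span_base by blast
    have indC: "independent ?C"
      using v(1) ind by (rule independent_insertI)
    have BC: "span B \<subseteq> span ?C"
      by (rule span_mono) auto
    have Tv: "T v = shift T a v + scale a v"
      by (simp add: shift_def)
    \<comment> \<open>Coordinates of vectors in \<open>span B\<close> do not change, so the old
      diagonal entries persist.\<close>
    have repC: "representation ?C x = representation B x" if "x \<in> span B" for x
      using representation_extend[OF indC that] by auto
    have "T x \<in> span ?C" if x: "x \<in> span ?C" for x
    proof -
      obtain c where "x - scale c v \<in> span B"
        using x span_breakdown_eq by blast
      then have "T (x - scale c v) \<in> span ?C"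
        using inv BC by blast
      moreover have "scale c (T v) \<in> span ?C"
        unfolding Tv using subsetD[OF BC v(2)] by (intro span_add span_scale) (simp_all add: span_base)
      ultimately have "T (x - scale c v) + scale c (T v) \<in> span ?C"
        by (rule span_add)
      then show ?thesis
        by (simp add: endo_diff[OF T] endo_scale[OF T])
    qed
    moreover have "representation ?C (T v) v = a"
    proof -
      have "representation ?C (T v) v = representation B (shift T a v) v + a * representation ?C v v"
        unfolding Tv using subsetD[OF BC v(2)]
        by (subst representation_add[OF indC])
          (simp_all add: repC[OF v(2)] representation_scale[OF indC] span_base span_scale)
      moreover have "representation B (shift T a v) v = 0"
        using vB representation_ne_zero by blast
      ultimately show ?thesis
        by (simp add: representation_basis[OF indC])
    qed
    moreover have "representation ?C (T b) b = \<alpha> b" if "b \<in> B" for b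
      using that inv span_base[OF that] by (subst repC) (auto simp: \<alpha>)
    ultimately have "good ?C"
      unfolding good_def using indC va \<alpha>(1) vB
      by (intro conjI exI[of _ "\<alpha>(v := a)"]) auto
    then have "card ?C \<le> card B"
      by (rule max)
    then show False
      using vB fin by simp
  qed
  then show ?thesis
    using that fin ind \<alpha> by blast
qed

end

section \<open>Derivations and the Killing form\<close>

locale fd_lie_algebra = lie_algebra scale bracket + fdvs scale Basis
  for scale :: "'k::field \<Rightarrow> 'a::ab_group_add \<Rightarrow> 'a"
    and bracket :: "'a \<Rightarrow> 'a \<Rightarrow> 'a" and Basis :: "'a set"
begin

lemma endo_bracket: "endo (bracket x)" "endo (\<lambda>y. bracket y x)"
  by (simp_all add: endoI bracket_add_right bracket_scale_right bracket_add_left bracket_scale_left)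

lemmas bracket_zero_right [simp] = endo_zero[OF endo_bracket(1)]
  and bracket_zero_left [simp] = endo_zero[OF endo_bracket(2)]
  and bracket_diff_right = endo_diff[OF endo_bracket(1)]
  and bracket_diff_left = endo_diff[OF endo_bracket(2)]
  and bracket_minus_right = endo_minus[OF endo_bracket(1)]

lemma bracket_antisym: "bracket x y = - bracket y x"
proof -
  have "bracket x y + bracket y x = 0"
    using bracket_self[of "x + y", unfolded bracket_add_left bracket_add_right]
    by (simp add: bracket_self add.commute)
  then show ?thesis
    by (simp add: eq_neg_iff_add_eq_0)
qed

lemma bracket_bracket: "bracket (bracket x y) z = bracket x (bracket y z) - bracket y (bracket x z)"
proof -
  have "bracket y (bracket z x) = - bracket y (bracket x z)"
    by (subst bracket_antisym) (simp add: bracket_minus_right)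
  moreover have "bracket z (bracket x y) = - bracket (bracket x y) z"
    by (rule bracket_antisym)
  ultimately show ?thesis
    using jacobi[of x y z] by (simp add: algebra_simps)
qed

definition derivation :: "('a \<Rightarrow> 'a) \<Rightarrow> bool" where
  "derivation D \<longleftrightarrow> endo D \<and> (\<forall>x y. D (bracket x y) = bracket (D x) y + bracket x (D y))"

lemma derivation_bracket: "derivation (bracket x)"
  unfolding derivation_def using endo_bracket by (simp add: bracket_bracket)

lemma derivation_diff:
  assumes "derivation D" "derivation E"
  shows "derivation (\<lambda>x. D x - E x)"
  using assms unfolding derivation_def
  by (auto simp: endo_sub bracket_diff_left bracket_diff_right)

definition killing :: "'a \<Rightarrow> 'a \<Rightarrow> 'k" where
  "killing x y = trace (\<lambda>z. bracket x (bracket y z))"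

lemma killing_sym: "killing x y = killing y x"
  unfolding killing_def by (rule trace_comm[OF endo_bracket(1) endo_bracket(1)])

lemma killing_add_left: "killing (x + y) z = killing x z + killing y z"
  by (simp add: killing_def bracket_add_left trace_add)

lemma killing_scale_left: "killing (scale c x) z = c * killing x z"
  by (simp add: killing_def bracket_scale_left trace_scale)

lemma killing_invariant: "killing (bracket x y) z = killing x (bracket y z)"
proof -
  have "trace (\<lambda>v. bracket y (bracket x (bracket z v))) = trace (\<lambda>v. bracket x (bracket z (bracket y v)))"
    by (rule trace_comm[OF endo_bracket(1) endo_compose[OF endo_bracket(1) endo_bracket(1)]])
  then show ?thesis
    by (simp add: killing_def bracket_bracket bracket_diff_right trace_diff)
qed

text \<open>The commutator of \<open>D\<close> and \<open>ad v\<close> is \<open>ad (D v)\<close>;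
  cyclicity of the trace does the rest. This serves both for solvability of the Killing radical and
  for innerness of derivations.\<close>

lemma trace_bracket_derivation:
  assumes "derivation D"
  shows "trace (\<lambda>z. bracket (bracket u v) (D z)) = - killing u (D v)"
proof -
  have D: "endo D" and der: "bracket v (D z) = D (bracket v z) - bracket (D v) z" for z
    using assms by (auto simp: derivation_def)
  have "trace (\<lambda>z. bracket v (bracket u (D z))) = trace (\<lambda>z. bracket u (D (bracket v z)))"
    by (rule trace_comm[OF endo_bracket(1) endo_compose[OF endo_bracket(1) D]])
  then show ?thesis
    by (simp add: killing_def bracket_bracket bracket_diff_right trace_diff der)
qed

text \<open>By the Leibniz rule, \<open>D - (a + b)\<close> sends \<open>[u, v]\<close> to
  \<open>[(D - a) u, v] + [u, (D - b) v]\<close>. Each summand lowers one of the two nilpotency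
  orders, whence the induction on \<open>m + n\<close>.\<close>

lemma bracket_gen_eigenspaces:
  assumes D: "derivation D" and "u \<in> gen_eigenspace D a" "v \<in> gen_eigenspace D b"
  shows "bracket u v \<in> gen_eigenspace D (a + b)"
proof -
  have E: "endo D"
    using D by (simp add: derivation_def)
  have "bracket u v \<in> gen_eigenspace D (a + b)"
    if "(shift D a ^^ m) u = 0" "(shift D b ^^ n) v = 0" for m n
    using that
  proof (induction "m + n" arbitrary: m n u v rule: less_induct)
    case less
    note zero = subspace_0[OF subspace_gen_eigenspace[OF E]]
    show ?case
    proof (cases "m = 0 \<or> n = 0")
      case True
      then show ?thesis
        using less.prems zero by auto
    next
      case False
      then obtain m' n' where mn: "m = Suc m'" "n = Suc n'"
        using not0_implies_Suc by blast
      have "bracket (shift D a u) v \<in> gen_eigenspace D (a + b)"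
        using less.hyps[of m' n "shift D a u" v] less.prems mn by (simp add: funpow_swap1)
      moreover have "bracket u (shift D b v) \<in> gen_eigenspace D (a + b)"
        using less.hyps[of m n' u "shift D b v"] less.prems mn by (simp add: funpow_swap1)
      moreover have "shift D (a + b) (bracket u v) = bracket (shift D a u) v + bracket u (shift D b v)"
        using D by (simp add: shift_def derivation_def bracket_diff_left bracket_diff_right
            bracket_scale_left bracket_scale_right scale_left_distrib)
      ultimately have "shift D (a + b) (bracket u v) \<in> gen_eigenspace D (a + b)"
        by (simp add: subspace_add[OF subspace_gen_eigenspace[OF E]])
      then show ?thesis
        using gen_eigenspace_shift_iff[OF E] by blast
    qed
  qed
  then show ?thesis
    using assms(2,3) by (auto simp: gen_eigenspace_def)
qed

section \<open>Engel's theorem\<close>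

definition lie_subalgebra :: "'a set \<Rightarrow> bool" where
  "lie_subalgebra K \<longleftrightarrow> subspace K \<and> (\<forall>x\<in>K. \<forall>y\<in>K. bracket x y \<in> K)"

text \<open>Engel's theorem for the action of \<open>K\<close> on \<open>W / U\<close>, phrased without quotients so that the
  induction can use the action of a maximal subalgebra \<open>L\<close> of \<open>K\<close> on \<open>K / L\<close>.\<close>

lemma engel_relative:
  assumes "lie_subalgebra K" "\<And>x v. x \<in> K \<Longrightarrow> \<exists>n. (bracket x ^^ n) v = 0"
    and "subspace U" "subspace W" "U \<subset> W"
    and "\<And>x u. x \<in> K \<Longrightarrow> u \<in> U \<Longrightarrow> bracket x u \<in> U"
    and "\<And>x w. x \<in> K \<Longrightarrow> w \<in> W \<Longrightarrow> bracket x w \<in> W"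
  shows "\<exists>v\<in>W - U. \<forall>x\<in>K. bracket x v \<in> U"
  using assms
proof (induction "dim K" arbitrary: K U W rule: less_induct)
  case less
  show ?case
  proof (cases "K = {0}")
    case True
    then show ?thesis
      using less.prems(3,5) subspace_0 by auto
  next
    case False
    \<comment> \<open>A proper subalgebra \<open>L\<close> of largest dimension is chosen;
      \<open>{0}\<close> is a candidate because \<open>K\<close> is nonzero.\<close>
    let ?P = "\<lambda>L. lie_subalgebra L \<and> L \<subset> K"
    have "?P {0}"
      using False less.prems(1) subspace_0 by (auto simp: lie_subalgebra_def)
    moreover have "\<And>L. ?P L \<Longrightarrow> dim L < Suc (dim K)"
      by (simp add: dim_subset le_imp_less_Suc psubset_imp_subset)
    ultimately obtain L where L: "?P L" and max: "\<And>L'. ?P L' \<Longrightarrow> dim L' \<le> dim L"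
      using ex_has_greatest_nat[of ?P "{0}" dim "Suc (dim K)"] by blast
    have sub: "subspace K" "subspace L"
      using less.prems(1) L by (auto simp: lie_subalgebra_def)
    have LK: "L \<subseteq> K"
      using L by blast
    have dimL: "dim L < dim K"
      using L sub dim_psubset[of L K] by (metis span_eq_iff)
    \<comment> \<open>The induction hypothesis for \<open>L\<close> acting on \<open>K / L\<close>
      gives an \<open>x\<close> outside \<open>L\<close> that normalises \<open>L\<close>.\<close>
    have "\<exists>x\<in>K - L. \<forall>y\<in>L. bracket y x \<in> L"
      by (rule less.hyps[OF dimL]) (use L sub less.prems in \<open>auto simp: lie_subalgebra_def\<close>)
    then obtain x where x: "x \<in> K" "x \<notin> L" "\<And>y. y \<in> L \<Longrightarrow> bracket y x \<in> L"
      by blast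
    have x': "bracket x y \<in> L" if "y \<in> L" for y
      using x(3)[OF that] sub(2) subspace_neg bracket_antisym[of x y] by metis
    \<comment> \<open>This is a strictly larger subalgebra, hence all of \<open>K\<close> by the
      choice of \<open>L\<close>.\<close>
    let ?L = "span (insert x L)"
    have memL: "z \<in> ?L \<longleftrightarrow> (\<exists>c. z - scale c x \<in> L)" for z
      using span_breakdown_eq[of z x L] sub(2) by (simp add: span_eq_iff[THEN iffD2])
    have LK': "?L \<subseteq> K"
      using x(1) LK sub(1) by (intro span_minimal) auto
    have "bracket u v \<in> ?L" if uv: "u \<in> ?L" "v \<in> ?L" for u v
    proof -
      obtain c d where cd: "u - scale c x \<in> L" "v - scale d x \<in> L"
        using uv memL by blast
      define u' where "u' = u - scale c x"
      define v' where "v' = v - scale d x"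
      have "bracket u v = bracket (u' + scale c x) (v' + scale d x)"
        by (simp add: u'_def v'_def)
      also have "\<dots> = bracket u' v' + scale d (bracket u' x) + scale c (bracket x v')"
        by (simp add: bracket_add_left bracket_add_right bracket_scale_left bracket_scale_right
            bracket_self)
      also have "\<dots> \<in> L"
        using cd L x(3) x' sub(2) unfolding u'_def[symmetric] v'_def[symmetric]
        by (intro subspace_add subspace_scale) (auto simp: lie_subalgebra_def)
      finally show ?thesis
        using span_superset by blast
    qed
    then have subL: "lie_subalgebra ?L"
      by (auto simp: lie_subalgebra_def)
    have "L \<subset> ?L"
      using x(2) span_superset[of "insert x L"] by blast
    then have "dim L < dim ?L"
      using sub(2) dim_psubset[of L ?L] by (metis span_eq_iff span_span)
    then have K: "?L = K"
      using max[of ?L] subL LK' by fastforce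
    \<comment> \<open>The vectors killed by \<open>L\<close> modulo \<open>U\<close>. They are
      stable under \<open>bracket x\<close> because \<open>x\<close> normalises \<open>L\<close>,
      and the induction hypothesis provides one outside \<open>U\<close>.\<close>
    define W0 where "W0 = {w \<in> W. \<forall>y\<in>L. bracket y w \<in> U}"
    have "\<exists>v\<in>W - U. \<forall>y\<in>L. bracket y v \<in> U"
      by (rule less.hyps[OF dimL]) (use L LK less.prems in auto)
    then obtain w where w: "w \<in> W0" "w \<notin> U"
      by (auto simp: W0_def)
    have stable: "bracket x v \<in> W0" if "v \<in> W0" for v
    proof -
      have "bracket y (bracket x v) \<in> U" if y: "y \<in> L" for y
      proof -
        have "bracket y (bracket x v) = bracket (bracket y x) v + bracket x (bracket y v)"
          by (simp add: bracket_bracket)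
        then show ?thesis
          using y x \<open>v \<in> W0\<close> less.prems(3,6) by (auto simp: W0_def subspace_add)
      qed
      then show ?thesis
        using \<open>v \<in> W0\<close> x(1) less.prems(7) by (auto simp: W0_def)
    qed
    \<comment> \<open>Where the orbit of \<open>w\<close> under \<open>bracket x\<close> enters
      \<open>U\<close>, the preceding vector is killed modulo \<open>U\<close> by \<open>x\<close>
      and, being in \<open>W0\<close>, by \<open>L\<close>.\<close>
    obtain m where "(bracket x ^^ m) w = 0"
      using less.prems(2) x(1) by blast
    then have "(bracket x ^^ m) w \<in> U"
      using less.prems(3) subspace_0 by simp
    from last_power_outside[OF this w(2)] obtain k where
      k: "(bracket x ^^ k) w \<notin> U" "bracket x ((bracket x ^^ k) w) \<in> U"
      by blast
    define v where "v = (bracket x ^^ k) w"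
    have "(bracket x ^^ i) w \<in> W0" for i
      by (induction i) (auto intro: stable w(1))
    then have v: "v \<in> W0"
      unfolding v_def by blast
    have "bracket z v \<in> U" if z: "z \<in> K" for z
    proof -
      obtain c where c: "z - scale c x \<in> L"
        using z memL[of z] unfolding K by blast
      have "bracket z v = bracket (z - scale c x) v + scale c (bracket x v)"
        by (simp add: bracket_diff_left bracket_scale_left)
      moreover have "bracket (z - scale c x) v \<in> U" "bracket x v \<in> U"
        using c v k(2) by (auto simp: W0_def v_def)
      ultimately show ?thesis
        using less.prems(3) by (simp add: subspace_add subspace_scale)
    qed
    moreover have "v \<in> W - U"
      using v k(1) by (auto simp: W0_def v_def)
    ultimately show ?thesis
      by blast
  qed
qed

section \<open>Solvability from nilpotency\<close>

lemma subspace_derived: "subspace (derived S)"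
  by (simp add: derived_def)

lemma bracket_in_derived: "x \<in> S \<Longrightarrow> y \<in> S \<Longrightarrow> bracket x y \<in> derived S"
  unfolding derived_def by (rule span_base) blast

lemma derived_subset: "lie_subalgebra S \<Longrightarrow> derived S \<subseteq> S"
  unfolding derived_def lie_subalgebra_def by (rule span_minimal) auto

lemma lie_subalgebra_derived:
  assumes "lie_subalgebra S"
  shows "lie_subalgebra (derived S)"
  unfolding lie_subalgebra_def
  using derived_subset[OF assms] bracket_in_derived subspace_derived by blast

text \<open>For a maximal proper \<open>I\<close>-stable subspace \<open>U\<close> of
  \<open>I\<close>, Engel's theorem gives \<open>v\<close> outside \<open>U\<close> with
  \<open>[I, v]\<close> in \<open>U\<close>. Maximality makes \<open>U\<close> and \<open>v\<close>
  span \<open>I\<close>, so \<open>[I, I]\<close> lies in \<open>U\<close>, against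
  perfectness.\<close>

lemma perfect_nilpotent_zero:
  assumes I: "lie_subalgebra I" "derived I = I"
    and nil: "\<And>x v. x \<in> I \<Longrightarrow> \<exists>n. (bracket x ^^ n) v = 0"
  shows "I = {0}"
proof (rule ccontr)
  assume "I \<noteq> {0}"
  let ?P = "\<lambda>U. subspace U \<and> U \<subset> I \<and> (\<forall>x\<in>I. \<forall>u\<in>U. bracket x u \<in> U)"
  have sub: "subspace I"
    using I by (simp add: lie_subalgebra_def)
  have "?P {0}"
    using \<open>I \<noteq> {0}\<close> subspace_0[OF sub] by auto
  moreover have "\<And>U. ?P U \<Longrightarrow> dim U < Suc (dim I)"
    by (simp add: dim_subset le_imp_less_Suc psubset_imp_subset)
  ultimately obtain U where U: "?P U" and max: "\<And>U'. ?P U' \<Longrightarrow> dim U' \<le> dim U"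
    using ex_has_greatest_nat[of ?P "{0}" dim "Suc (dim I)"] by blast
  have "\<exists>v\<in>I - U. \<forall>x\<in>I. bracket x v \<in> U"
    by (rule engel_relative) (use I U sub nil in \<open>auto simp: lie_subalgebra_def\<close>)
  then obtain v where v: "v \<in> I" "v \<notin> U" "\<And>x. x \<in> I \<Longrightarrow> bracket x v \<in> U"
    by blast
  let ?V = "span (insert v U)"
  have memV: "z \<in> ?V \<longleftrightarrow> (\<exists>c. z - scale c v \<in> U)" for z
    using span_breakdown_eq[of z v U] U by (simp add: span_eq_iff[THEN iffD2])
  have VU: "bracket x z \<in> U" if xz: "x \<in> I" "z \<in> ?V" for x z
  proof -
    obtain c where c: "z - scale c v \<in> U"
      using xz(2) memV[of z] by blast
    have "bracket x z = bracket x (z - scale c v) + scale c (bracket x v)"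
      by (simp add: bracket_diff_right bracket_scale_right)
    then show ?thesis
      using c U v(3) xz(1) by (simp add: subspace_add subspace_scale)
  qed
  have UV: "U \<subset> ?V"
    using v(2) span_superset[of "insert v U"] by blast
  have "?V \<subseteq> I"
    using v(1) U sub by (intro span_minimal) auto
  moreover have "dim U < dim ?V"
    using UV U dim_psubset[of U ?V] by (metis span_eq_iff span_span)
  ultimately have "?V = I"
    using max[of ?V] VU UV by fastforce
  then have "derived I \<subseteq> U"
    unfolding derived_def using VU U by (intro span_minimal) auto
  then show False
    using I(2) U by blast
qed

text \<open>A term of least dimension in the derived series is perfect and consists of ad-nilpotent
  elements, hence is zero.\<close>

lemma nilpotent_derived_solvable:
  assumes S: "lie_subalgebra S"
    and nil: "\<And>x v. x \<in> derived S \<Longrightarrow> \<exists>n. (bracket x ^^ n) v = 0"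
  shows "solvable S"
proof -
  let ?D = "\<lambda>n. (derived ^^ n) S"
  have subalg: "lie_subalgebra (?D n)" for n
    by (induction n) (simp_all add: S lie_subalgebra_derived)
  obtain n where min: "\<And>m. dim (?D n) \<le> dim (?D m)"
    using ex_has_least_nat[of "\<lambda>_. True" 0 "\<lambda>n. dim (?D n)"] by auto
  have stable: "derived (?D n) = ?D n"
    using subspace_dim_equal[OF subspace_derived _ derived_subset[OF subalg], of n] min[of "Suc n"] subalg
    by (simp add: lie_subalgebra_def)
  have "?D (Suc n) \<subseteq> derived S" for n
  proof (induction n)
    case (Suc n)
    then show ?case
      using derived_subset[OF subalg, of "Suc n"] by simp
  qed simp
  \<comment> \<open>The inclusion is known only from index 1 on; stability identifies
    \<open>?D n\<close> with \<open>?D (Suc n)\<close>, which covers \<open>n = 0\<close>.\<close>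
  then have "?D n \<subseteq> derived S"
    using stable by (metis comp_apply funpow.simps(2))
  then have "?D n = {0}"
    using nil by (intro perfect_nilpotent_zero[OF subalg stable]) blast
  then show ?thesis
    unfolding solvable_def by blast
qed

end

section \<open>Nondegeneracy of the Killing form\<close>

locale complex_lie_algebra = fd_lie_algebra scale bracket Basis + complex_fdvs scale Basis
  for scale :: "complex \<Rightarrow> 'a::ab_group_add \<Rightarrow> 'a"
    and bracket :: "'a \<Rightarrow> 'a \<Rightarrow> 'a" and Basis :: "'a set"
begin

lemma endo_zero_on_span: "endo f \<Longrightarrow> span S = UNIV \<Longrightarrow> (\<And>s. s \<in> S \<Longrightarrow> f s = 0) \<Longrightarrow> f v = 0"
  using span_minimal[of S "{x. f x = 0}"] subspace_kernel_endo[of f] by blast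

text \<open>Conjugation is additive, so the conjugated eigenvalues still add under brackets and
  \<open>Y\<close> obeys the Leibniz rule. It serves as a test operator whose trace against
  \<open>D\<close> detects every nonzero eigenvalue.\<close>

lemma conj_derivation:
  assumes D: "derivation D"
  obtains Y where "derivation Y" "trace (\<lambda>v. D (Y v)) = 0 \<Longrightarrow> \<forall>v. \<exists>n. (D ^^ n) v = 0"
proof -
  have E: "endo D"
    using D by (simp add: derivation_def)
  obtain B \<alpha> where B: "finite B" "independent B" "span B = UNIV"
    and \<alpha>: "\<And>b. b \<in> B \<Longrightarrow> b \<in> gen_eigenspace D (\<alpha> b)"
      "\<And>b. b \<in> B \<Longrightarrow> representation B (D b) b = \<alpha> b"
    using triangular_basis[OF E] by blast
  let ?F = "\<alpha> ` B"
  \<comment> \<open>The projection onto the generalised \<open>c\<close>-eigenspace along the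
    others; it vanishes when \<open>c\<close> is not a value of \<open>\<alpha>\<close>.\<close>
  define P where "P c v = (\<Sum>b | b \<in> B \<and> \<alpha> b = c. scale (representation B v b) b)" for c v
  have P_mem: "P c v \<in> gen_eigenspace D c" for c v
    unfolding P_def using \<alpha>(1)
    by (intro subspace_sum subspace_scale subspace_gen_eigenspace E) auto
  have P_sum: "(\<Sum>c\<in>?F. P c v) = v" for v
  proof -
    have "(\<Sum>c\<in>?F. P c v) = (\<Sum>b\<in>B. scale (representation B v b) b)"
      unfolding P_def using B(1) by (rule sum.image_gen[symmetric])
    then show ?thesis
      using sum_representation_eq[OF B(2) _ B(1) order_refl, of v] B(3) by simp
  qed
  have endo_P: "endo (P c)" for c
    by (rule endoI) (simp_all add: P_def B representation_add representation_scale
        scale_left_distrib sum.distrib scale_sum_right)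
  have P_eig: "P c v = (if c = a then v else 0)" if v: "v \<in> gen_eigenspace D a" for a c v
  proof -
    have outside: "P c v = 0" if "c \<notin> ?F" for c
      using that unfolding P_def by (intro sum.neutral) auto
    \<comment> \<open>Two decompositions of \<open>v\<close> into generalised eigenvectors are
      compared: the one by \<open>P\<close>, and \<open>v\<close> itself. The index \<open>a\<close>
      is inserted because it might not be a value of \<open>\<alpha>\<close>.\<close>
    let ?u = "\<lambda>c. P c v - (if c = a then v else 0)"
    have "(\<Sum>c\<in>insert a ?F. ?u c) = (\<Sum>c\<in>insert a ?F. P c v) - v"
      using B(1) by (simp add: sum_subtractf del: sum.insert_if sum.insert)
    also have "(\<Sum>c\<in>insert a ?F. P c v) = (\<Sum>c\<in>?F. P c v)"
      by (rule sum.mono_neutral_right) (use B(1) outside in auto)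
    finally have "(\<Sum>c\<in>insert a ?F. ?u c) = 0"
      by (simp add: P_sum)
    moreover have "?u c \<in> gen_eigenspace D c" for c
      using v P_mem[of c v] subspace_0[OF subspace_gen_eigenspace[OF E]]
      by (auto intro!: subspace_diff[OF subspace_gen_eigenspace[OF E]])
    ultimately have u0: "\<forall>c\<in>insert a ?F. ?u c = 0"
      using B(1) by (intro gen_eigenspaces_independent[OF E]) simp_all
    show ?thesis
    proof (cases "c \<in> insert a ?F")
      case True
      then show ?thesis
        using u0 by (metis right_minus_eq)
    next
      case False
      then show ?thesis
        using outside by simp
    qed
  qed
  define Y where "Y v = (\<Sum>c\<in>?F. scale (cnj c) (P c v))" for v
  have endo_Y: "endo Y"
    by (rule endoI) (simp_all add: Y_def endo_add[OF endo_P] endo_scale[OF endo_P]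
        scale_right_distrib sum.distrib scale_sum_right mult.commute)
  have Y_eig: "Y v = scale (cnj a) v" if v: "v \<in> gen_eigenspace D a" for a v
  proof -
    have "Y v = (\<Sum>c\<in>?F. scale (cnj a) (P c v))"
      unfolding Y_def by (rule sum.cong) (auto simp: P_eig[OF v])
    also have "\<dots> = scale (cnj a) v"
      by (simp only: scale_sum_right[symmetric] P_sum)
    finally show ?thesis .
  qed
  \<comment> \<open>The defect of the Leibniz rule is bilinear, so it suffices that it vanishes on
    the eigenvector basis.\<close>
  let ?d = "\<lambda>u v. Y (bracket u v) - bracket (Y u) v - bracket u (Y v)"
  have d_endo: "endo (?d u)" "endo (\<lambda>u. ?d u v)" for u v
    by (auto intro!: endoI simp: endo_add[OF endo_Y] endo_scale[OF endo_Y] bracket_add_left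
        bracket_add_right bracket_scale_left bracket_scale_right scale_right_diff_distrib)
  have "?d u v = 0" if "u \<in> B" "v \<in> B" for u v
    using \<alpha>(1)[OF that(1)] \<alpha>(1)[OF that(2)]
    by (simp add: Y_eig[of _ "\<alpha> u"] Y_eig[of _ "\<alpha> v"] Y_eig[OF bracket_gen_eigenspaces[OF D]]
        bracket_scale_left bracket_scale_right scale_left_distrib)
  then have "?d u v = 0" if "u \<in> B" for u v
    using endo_zero_on_span[OF d_endo(1)[of u] B(3)] that by simp
  then have "?d u v = 0" for u v
    using endo_zero_on_span[OF d_endo(2)[of v] B(3)] by simp
  then have "derivation Y"
    unfolding derivation_def using endo_Y by (simp add: algebra_simps)
  moreover have "\<forall>v. \<exists>n. (D ^^ n) v = 0" if tr: "trace (\<lambda>v. D (Y v)) = 0"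
  proof -
    have DY: "representation B (D (Y b)) b = of_real ((cmod (\<alpha> b))\<^sup>2)" if "b \<in> B" for b
      using \<alpha>[OF that] B(2,3)
      by (simp add: Y_eig endo_scale[OF E] representation_scale complex_norm_square mult.commute
          del: of_real_power)
    have "trace (\<lambda>v. D (Y v)) = (\<Sum>b\<in>B. representation B (D (Y b)) b)"
      by (rule trace_any_basis[OF B endo_compose[OF E endo_Y]])
    also have "\<dots> = of_real (\<Sum>b\<in>B. (cmod (\<alpha> b))\<^sup>2)"
      by (simp add: DY)
    finally have "(\<Sum>b\<in>B. (cmod (\<alpha> b))\<^sup>2) = 0"
      using tr by (metis of_real_eq_0_iff)
    then have "\<forall>b\<in>B. \<alpha> b = 0"
      using B(1) by (simp add: sum_nonneg_eq_0_iff)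
    then have "B \<subseteq> gen_eigenspace D 0"
      using \<alpha>(1) by force
    then have "span B \<subseteq> gen_eigenspace D 0"
      by (rule span_minimal) (rule subspace_gen_eigenspace[OF E])
    moreover have "shift D 0 = D"
      by (simp add: shift_def fun_eq_iff)
    ultimately show ?thesis
      using B(3) by (auto simp: gen_eigenspace_def)
  qed
  ultimately show ?thesis
    using that by blast
qed

definition killing_radical :: "'a set" where
  "killing_radical = {x. \<forall>y. killing x y = 0}"

lemma subspace_killing_radical: "subspace killing_radical"
  by (rule subspaceI)
    (simp_all add: killing_radical_def killing_add_left killing_scale_left, simp add: killing_def trace_zero)

lemma lie_ideal_killing_radical: "lie_ideal killing_radical"
proof -
  have "bracket x y \<in> killing_radical" if "y \<in> killing_radical" for x y
    using that killing_invariant[of y x] bracket_antisym[of x y] subspace_neg[OF subspace_killing_radical]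
    by (simp add: killing_radical_def)
  then show ?thesis
    by (simp add: lie_ideal_def subspace_killing_radical)
qed

text \<open>For \<open>u\<close> in the radical,
  \<open>tr (ad [u, v] Y) = - killing u (Y v) = 0\<close>. By linearity the trace vanishes on the
  derived algebra, whose elements are therefore ad-nilpotent.\<close>

lemma solvable_killing_radical: "solvable killing_radical"
proof (rule nilpotent_derived_solvable)
  show "lie_subalgebra killing_radical"
    using lie_ideal_killing_radical by (simp add: lie_ideal_def lie_subalgebra_def)
next
  fix x v assume x: "x \<in> derived killing_radical"
  obtain Y where Y: "derivation Y" and nil: "trace (\<lambda>v. bracket x (Y v)) = 0 \<Longrightarrow> \<forall>v. \<exists>n. (bracket x ^^ n) v = 0"
    using conj_derivation[OF derivation_bracket] by blast
  let ?K = "{x. trace (\<lambda>v. bracket x (Y v)) = 0}"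
  have "subspace ?K"
    by (rule subspaceI) (simp_all add: bracket_add_left bracket_scale_left trace_add trace_scale trace_zero)
  moreover have "{bracket x y |x y. x \<in> killing_radical \<and> y \<in> killing_radical} \<subseteq> ?K"
    by (auto simp: trace_bracket_derivation[OF Y] killing_radical_def)
  ultimately have "derived killing_radical \<subseteq> ?K"
    unfolding derived_def by (intro span_minimal)
  then show "\<exists>n. (bracket x ^^ n) v = 0"
    using x nil by blast
qed

end

section \<open>Derivations of semisimple Lie algebras\<close>

locale complex_semisimple = complex_lie_algebra +
  assumes semisimple: semisimple
begin

lemma killing_nondegenerate: "(\<And>y. killing x y = 0) \<Longrightarrow> x = 0"
  using semisimple lie_ideal_killing_radical solvable_killing_radical
  by (auto simp: semisimple_def killing_radical_def)

lemma central_imp_zero: "(\<And>y. bracket x y = 0) \<Longrightarrow> x = 0"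
  by (rule killing_nondegenerate) (simp add: killing_def trace_zero)

text \<open>The Killing form identifies the algebra with its dual. The dual is replaced by
  coordinate vectors, so that \<open>\<Theta>\<close> is an endomorphism and its injectivity gives
  surjectivity.\<close>

lemma killing_represents:
  assumes "\<And>x y. f (x + y) = f x + f y" "\<And>c x. f (scale c x) = c * f x"
  shows "\<exists>x. \<forall>y. killing x y = f y"
proof -
  define \<Theta> where "\<Theta> x = (\<Sum>b\<in>Basis. scale (killing x b) b)" for x
  have coeffs: "g = h" if eq: "\<And>b. b \<in> Basis \<Longrightarrow> g b = h b"
      and g: "\<And>x y. g (x + y) = g x + g y" "\<And>c x. g (scale c x) = c * g x"
      and h: "\<And>x y. h (x + y) = h x + h y" "\<And>c x. h (scale c x) = c * h x"
    for g h :: "'a \<Rightarrow> complex"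
  proof
    fix y
    have "y \<in> span Basis"
      by (simp add: span_Basis)
    then show "g y = h y"
    proof (induction rule: span_induct_alt)
      case base
      show ?case
        using g(2)[of 0 0] h(2)[of 0 0] by simp
    qed (simp add: eq g h)
  qed
  have k: "killing x (y + z) = killing x y + killing x z" "killing x (scale c y) = c * killing x y" for x y z c
    by (simp_all add: killing_sym[of x] killing_add_left killing_scale_left)
  have endo: "endo \<Theta>"
    by (rule endoI) (simp_all add: \<Theta>_def killing_add_left killing_scale_left scale_left_distrib
        sum.distrib scale_sum_right)
  have indep: "\<forall>b\<in>Basis. u b = w b" if "(\<Sum>b\<in>Basis. scale (u b) b) = (\<Sum>b\<in>Basis. scale (w b) b)" for u w
  proof -
    have "(\<Sum>b\<in>Basis. scale (u b - w b) b) = 0"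
      using that by (simp add: scale_left_diff_distrib sum_subtractf)
    then show ?thesis
      using independentD[OF independent_Basis finite_Basis order_refl, of "\<lambda>b. u b - w b"] by auto
  qed
  have "x = 0" if "\<Theta> x = 0" for x
  proof (rule killing_nondegenerate)
    have "\<forall>b\<in>Basis. killing x b = 0"
      using that indep[of "killing x" "\<lambda>_. 0"] by (simp add: \<Theta>_def)
    then show "killing x y = 0" for y
      using coeffs[of "killing x" "\<lambda>_. 0"] k by (simp add: fun_eq_iff)
  qed
  then have "inj \<Theta>"
    by (metis (no_types, lifting) endo endo_diff eq_iff_diff_eq_0 injI)
  then have "surj \<Theta>"
    by (rule linear_inj_imp_surj[OF endo])
  then obtain x where "\<Theta> x = (\<Sum>b\<in>Basis. scale (f b) b)"
    by (metis surjD)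
  then have "\<forall>b\<in>Basis. killing x b = f b"
    unfolding \<Theta>_def by (rule indep)
  then have "killing x = f"
    using coeffs[of "killing x" f] k assms by blast
  then show ?thesis
    by auto
qed

text \<open>Choose \<open>x\<close> representing the functional
  \<open>y \<mapsto> tr (ad y D)\<close>. Then \<open>E = D - ad x\<close> has zero trace against
  every \<open>ad y\<close>, so each \<open>E v\<close> is orthogonal to the whole algebra.\<close>

lemma derivation_inner:
  assumes D: "derivation D"
  obtains x where "D = bracket x"
proof -
  have "\<exists>x. \<forall>y. killing x y = trace (\<lambda>z. bracket y (D z))"
    by (rule killing_represents)
      (simp_all add: bracket_add_left bracket_scale_left trace_add trace_scale)
  then obtain x where x: "\<And>y. killing x y = trace (\<lambda>z. bracket y (D z))"
    by blast
  let ?E = "\<lambda>z. D z - bracket x z"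
  have E: "derivation ?E"
    by (rule derivation_diff[OF D derivation_bracket])
  have tr: "trace (\<lambda>z. bracket y (?E z)) = 0" for y
    using x[of y] killing_sym[of x y] by (simp add: bracket_diff_right trace_diff killing_def)
  have "?E v = 0" for v
  proof (rule killing_nondegenerate)
    show "killing (?E v) u = 0" for u
      using trace_bracket_derivation[OF E, of u v] tr killing_sym[of u] by simp
  qed
  then have "D = bracket x"
    by (simp add: fun_eq_iff)
  then show ?thesis
    by (rule that)
qed

text \<open>A nonzero functional vanishing on all brackets would be \<open>killing x\<close> for
  some \<open>x\<close>; by invariance such an \<open>x\<close> is central, hence zero.\<close>

lemma span_brackets: "span {bracket x y |x y. True} = UNIV"
proof (rule ccontr)
  let ?W = "span {bracket x y |x y. True}"
  assume "?W \<noteq> UNIV"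
  obtain C where C: "C \<subseteq> ?W" "independent C" "?W \<subseteq> span C"
    using maximal_independent_subset by blast
  have W: "span C = ?W"
    using C span_minimal[OF C(1) subspace_span] by blast
  let ?B = "extend_basis C"
  note B = independent_extend_basis[OF C(2)] span_extend_basis[OF C(2)]
  obtain v where v: "v \<in> ?B" "v \<notin> ?W"
    using \<open>?W \<noteq> UNIV\<close> B(2) span_minimal[of ?B ?W] subspace_span by blast
  \<comment> \<open>The functional is the coordinate at a basis vector \<open>v\<close> outside
    \<open>?W\<close>, in a basis extending one of \<open>?W\<close>.\<close>
  have "\<exists>x. \<forall>y. killing x y = representation ?B y v"
    by (rule killing_represents) (simp_all add: B representation_add representation_scale)
  then obtain x where x: "\<And>y. killing x y = representation ?B y v"
    by blast
  have "representation ?B w v = 0" if "w \<in> ?W" for w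
  proof -
    have "representation ?B w = representation C w"
      using representation_extend[OF B(1), of w C] that W extend_basis_superset[OF C(2)] by simp
    moreover have "representation C w v = 0"
      using v(2) C(1) representation_ne_zero[of C w v] by blast
    ultimately show ?thesis
      by simp
  qed
  then have "killing (bracket x y) z = 0" for y z
    unfolding killing_invariant x by (blast intro: span_base)
  then have "bracket x y = 0" for y
    by (intro killing_nondegenerate)
  then have "x = 0"
    by (rule central_imp_zero)
  then have "killing x v = 0"
    by (simp add: killing_def trace_zero)
  then show False
    using x[of v] representation_basis[OF B(1) v(1)] by simp
qed

section \<open>N-derivations\<close>

text \<open>The elements that every \<open>bracket x\<close> sends into \<open>G\<close> form a
  subspace containing all shorter brackets, thus everything. So \<open>G\<close> contains all
  brackets, which span.\<close>

lemma subspace_all_nested_brackets: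
  assumes "subspace G" "m \<ge> 1" "\<And>xs. length xs = m \<Longrightarrow> nested_bracket xs \<in> G"
  shows "G = UNIV"
  using assms(2,1,3)
proof (induction m arbitrary: G rule: nat_induct_at_least)
  case base
  then have "nested_bracket [x] \<in> G" for x
    by (metis One_nat_def length_Cons list.size(3))
  then show ?case
    by auto
next
  case (Suc m)
  let ?G = "{y. \<forall>x. bracket x y \<in> G}"
  have "subspace ?G"
    using Suc.prems(1) subspace_0
    by (intro subspaceI) (auto simp: bracket_add_right bracket_scale_right subspace_add subspace_scale)
  moreover have "nested_bracket ys \<in> ?G" if ys: "length ys = m" for ys
  proof -
    have "bracket x (nested_bracket ys) \<in> G" for x
      using Suc.prems(2)[of "x # ys"] ys Suc.hyps by (cases ys) auto
    then show ?thesis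
      by simp
  qed
  ultimately have "?G = UNIV"
    by (rule Suc.IH)
  then have "{bracket x y |x y. True} \<subseteq> G"
    by blast
  then show ?case
    using span_brackets span_minimal[OF _ Suc.prems(1)] by blast
qed

end

section \<open>Nested brackets as products of adjoint operators\<close>

context lie_algebra
begin

text \<open>The right-hand side of the defining identity, indexed by the list's own length so that
  it can be unfolded along the list.\<close>

definition nested_sum :: "('a \<Rightarrow> 'a) \<Rightarrow> 'a list \<Rightarrow> 'a" where
  "nested_sum f xs = (\<Sum>i<length xs. nested_bracket (xs[i := f (xs ! i)]))"

lemma nested_bracket_Cons: "xs \<noteq> [] \<Longrightarrow> nested_bracket (x # xs) = bracket x (nested_bracket xs)"
  by (cases xs) simp_all

end

context fd_lie_algebra
begin

lemma nested_sum_single: "nested_sum f [x] = f x"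
  by (simp add: nested_sum_def)

lemma nested_sum_Cons:
  assumes "xs \<noteq> []"
  shows "nested_sum f (x # xs) = bracket (f x) (nested_bracket xs) + bracket x (nested_sum f xs)"
proof -
  have ne: "xs[i := y] \<noteq> []" for i y
    using assms by (metis length_greater_0_conv length_list_update)
  show ?thesis
    unfolding nested_sum_def length_Cons sum.lessThan_Suc_shift
    by (simp add: nested_bracket_Cons[OF assms] nested_bracket_Cons[OF ne] endo_sum[OF endo_bracket(1)])
qed

text \<open>A pair \<open>(w, w')\<close> stands for the operator \<open>ad w + \<epsilon> ad w'\<close> over the dual numbers
  (\<open>\<epsilon>\<^sup>2 = 0\<close>). The functions below give the two components of a product of such operators, and
  \<open>pair_comm\<close> is the commutator.\<close>

fun ad_prod :: "('a \<times> 'a) list \<Rightarrow> 'a \<Rightarrow> 'a" where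
  "ad_prod [] z = z"
| "ad_prod (p # l) z = bracket (fst p) (ad_prod l z)"

fun ad_prod_eps :: "('a \<times> 'a) list \<Rightarrow> 'a \<Rightarrow> 'a" where
  "ad_prod_eps [] z = 0"
| "ad_prod_eps (p # l) z = bracket (snd p) (ad_prod l z) + bracket (fst p) (ad_prod_eps l z)"

definition pair_comm :: "'a \<times> 'a \<Rightarrow> 'a \<times> 'a \<Rightarrow> 'a \<times> 'a" where
  "pair_comm p q = (bracket (fst p) (fst q), bracket (snd p) (fst q) + bracket (fst p) (snd q))"

lemma ad_prod_comm:
  "ad_prod (l @ pair_comm p q # r) z = ad_prod (l @ p # q # r) z - ad_prod (l @ q # p # r) z"
  by (induction l) (simp_all add: pair_comm_def bracket_bracket bracket_diff_right)

lemma ad_prod_eps_comm: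
  "ad_prod_eps (l @ pair_comm p q # r) z
    = ad_prod_eps (l @ p # q # r) z - ad_prod_eps (l @ q # p # r) z"
proof (induction l)
  case Nil
  show ?case
    by (simp add: pair_comm_def bracket_bracket bracket_add_left bracket_add_right algebra_simps)
next
  case (Cons s l)
  then show ?case
    by (simp add: ad_prod_comm bracket_diff_right)
qed

text \<open>The \<open>\<epsilon>\<close>-component of the product is its commutator with \<open>\<phi>\<close>.\<close>

definition compatible :: "('a \<Rightarrow> 'a) \<Rightarrow> ('a \<times> 'a) list \<Rightarrow> bool" where
  "compatible \<phi> l \<longleftrightarrow> (\<forall>z. \<phi> (ad_prod l z) = ad_prod_eps l z + ad_prod l (\<phi> z))"

text \<open>The identity is additive in the operator product, and a product containing a commutator
  is a difference of two products.\<close>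

lemma compatible_pair_comm:
  assumes "endo \<phi>" "compatible \<phi> (l @ p # q # r)" "compatible \<phi> (l @ q # p # r)"
  shows "compatible \<phi> (l @ pair_comm p q # r)"
  using assms unfolding compatible_def by (simp add: ad_prod_comm ad_prod_eps_comm endo_diff)

text \<open>The iterated commutator of the operators \<open>ad x + \<epsilon> ad (\<phi> x)\<close>;
  its second component becomes the witness \<open>w'\<close> for normalising
  \<open>ad g\<close>.\<close>

fun nested_pair :: "('a \<Rightarrow> 'a) \<Rightarrow> 'a list \<Rightarrow> 'a \<times> 'a" where
  "nested_pair \<phi> [] = (0, 0)"
| "nested_pair \<phi> [x] = (x, \<phi> x)"
| "nested_pair \<phi> (x # y # ys) = pair_comm (x, \<phi> x) (nested_pair \<phi> (y # ys))"

lemma fst_nested_pair: "fst (nested_pair \<phi> xs) = nested_bracket xs"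
  by (induction \<phi> xs rule: nested_pair.induct) (simp_all add: pair_comm_def)

lemma nested_bracket_snoc: "nested_bracket (xs @ [z]) = ad_prod (map (\<lambda>x. (x, \<phi> x)) xs) z"
  by (induction xs) (simp_all add: nested_bracket_Cons)

lemma nested_sum_snoc:
  "nested_sum \<phi> (xs @ [z])
    = ad_prod_eps (map (\<lambda>x. (x, \<phi> x)) xs) z + ad_prod (map (\<lambda>x. (x, \<phi> x)) xs) (\<phi> z)"
proof (induction xs)
  case (Cons x xs)
  then show ?case
    by (simp add: nested_sum_Cons nested_bracket_snoc[of _ _ \<phi>] bracket_add_right add.assoc)
qed (simp add: nested_sum_single)

lemma N_derivation_nested_sum:
  "N_derivation N \<phi> \<longleftrightarrow> endo \<phi> \<and> (\<forall>xs. length xs = N \<longrightarrow> \<phi> (nested_bracket xs) = nested_sum \<phi> xs)"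
  by (auto simp: N_derivation_def nested_sum_def)

text \<open>The defining identity covers plain lists of \<open>M\<close> operators, and a block of
  neighbours is collapsed into one commutator step by step. The entry \<open>x\<close> joins
  \<open>ys\<close> in one ordering and \<open>zs\<close> in the other, so both must vary in the
  induction.\<close>

lemma compatible_nested_pair:
  assumes "N_derivation (Suc M) \<phi>" "xs \<noteq> []" "length ys + length xs + length zs = M"
  shows "compatible \<phi> (map (\<lambda>x. (x, \<phi> x)) ys @ nested_pair \<phi> xs # map (\<lambda>x. (x, \<phi> x)) zs)"
  using assms(2,3)
proof (induction xs arbitrary: ys zs rule: induct_list012)
  case (2 x)
  let ?xs = "ys @ x # zs"
  have "\<phi> (nested_bracket (?xs @ [z])) = nested_sum \<phi> (?xs @ [z])" for z
    using assms(1) 2 by (simp add: N_derivation_nested_sum)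
  then have "compatible \<phi> (map (\<lambda>x. (x, \<phi> x)) ?xs)"
    unfolding compatible_def nested_bracket_snoc[of _ _ \<phi>] nested_sum_snoc by blast
  then show ?case
    by simp
next
  case (3 x y xs)
  show ?case
    using assms(1) "3.IH"(2)[of "ys @ [x]" zs] "3.IH"(2)[of ys "x # zs"] "3.prems"
    by (simp add: compatible_pair_comm N_derivation_nested_sum)
qed simp

text \<open>The derivation \<open>ad w\<close> contributes a single bracket with \<open>w\<close>,
  whereas \<open>\<chi>\<close> can be pulled out of each slot and so contributes once per
  entry.\<close>

lemma nested_sum_centroid_plus_ad:
  assumes "\<And>x. \<phi> x = \<chi> x + bracket w x"
    and "\<And>x z. \<chi> (bracket x z) = bracket x (\<chi> z)" "\<And>x z. \<chi> (bracket x z) = bracket (\<chi> x) z"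
    and "xs \<noteq> []"
  shows "nested_sum \<phi> xs = scale (of_nat (length xs)) (\<chi> (nested_bracket xs)) + bracket w (nested_bracket xs)"
  using assms(4)
proof (induction xs rule: list_nonempty_induct)
  case (single x)
  show ?case
    by (simp add: nested_sum_single assms(1))
next
  case (cons x xs)
  let ?n = "nested_bracket xs"
  have "nested_sum \<phi> (x # xs) = bracket (\<chi> x) ?n + bracket (bracket w x) ?n
      + scale (of_nat (length xs)) (bracket x (\<chi> ?n)) + bracket x (bracket w ?n)"
    using cons
    by (simp add: nested_sum_Cons assms(1)[of x] bracket_add_left bracket_add_right bracket_scale_right)
  also have "\<dots> = scale (of_nat (length (x # xs))) (\<chi> (bracket x ?n)) + bracket w (bracket x ?n)"
    by (simp add: bracket_bracket assms(2)[symmetric] assms(3)[symmetric] scale_left_distrib)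
  finally show ?case
    using cons(1) by (simp add: nested_bracket_Cons)
qed

end

section \<open>Innerness of N-derivations\<close>

context complex_semisimple
begin

lemma N_derivation_normalizes_ad:
  assumes N: "N_derivation N \<phi>" and "N \<ge> 2"
  shows "\<exists>w'. \<forall>z. \<phi> (bracket w z) = bracket w' z + bracket w (\<phi> z)"
proof -
  obtain M where M: "N = Suc M" "M \<ge> 1"
    using assms(2) by (cases N) auto
  have E: "endo \<phi>"
    using N by (simp add: N_derivation_def)
  let ?G = "{w. \<exists>w'. \<forall>z. \<phi> (bracket w z) = bracket w' z + bracket w (\<phi> z)}"
  have "?G = UNIV"
  proof (rule subspace_all_nested_brackets[OF _ M(2)])
    show "subspace ?G"
    proof (rule subspaceI)
      show "0 \<in> ?G"
        by (auto intro!: exI[of _ 0] simp: endo_zero[OF E])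
    next
      fix x y assume "x \<in> ?G" "y \<in> ?G"
      then obtain x' y' where "\<forall>z. \<phi> (bracket x z) = bracket x' z + bracket x (\<phi> z)"
          "\<forall>z. \<phi> (bracket y z) = bracket y' z + bracket y (\<phi> z)"
        by blast
      then have "\<forall>z. \<phi> (bracket (x + y) z) = bracket (x' + y') z + bracket (x + y) (\<phi> z)"
        by (simp add: bracket_add_left endo_add[OF E])
      then show "x + y \<in> ?G"
        by blast
    next
      fix c x assume "x \<in> ?G"
      then obtain x' where "\<forall>z. \<phi> (bracket x z) = bracket x' z + bracket x (\<phi> z)"
        by blast
      then have "\<forall>z. \<phi> (bracket (scale c x) z) = bracket (scale c x') z + bracket (scale c x) (\<phi> z)"
        by (simp add: bracket_scale_left endo_scale[OF E] scale_right_distrib)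
      then show "scale c x \<in> ?G"
        by blast
    qed
  next
    fix xs :: "'a list" assume xs: "length xs = M"
    \<comment> \<open>Collapsing all \<open>M\<close> entries into one block leaves an identity
      about the single operator \<open>ad (nested_bracket xs)\<close>.\<close>
    then have "compatible \<phi> [nested_pair \<phi> xs]"
      using compatible_nested_pair[of M \<phi> xs "[]" "[]"] N M by fastforce
    then have "\<forall>z. \<phi> (bracket (nested_bracket xs) z)
        = bracket (snd (nested_pair \<phi> xs)) z + bracket (nested_bracket xs) (\<phi> z)"
      by (simp add: compatible_def fst_nested_pair)
    then show "nested_bracket xs \<in> ?G"
      by blast
  qed
  then show ?thesis
    by blast
qed

theorem N_derivation_inner:
  assumes N: "N_derivation N \<phi>" "N \<ge> 2"
  obtains x where "\<phi> = bracket x"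
proof -
  have E: "endo \<phi>"
    using N by (simp add: N_derivation_def)
  obtain \<psi> where \<psi>: "\<And>w z. \<phi> (bracket w z) = bracket (\<psi> w) z + bracket w (\<phi> z)"
    using N_derivation_normalizes_ad[OF N] by metis
  \<comment> \<open>As the centre is zero, \<open>ad\<close> is injective. Hence
    \<open>\<psi>\<close>, obtained by mere choice, is determined by its brackets, and linearity and
    the Leibniz rule can be tested there.\<close>
  have eqI: "x = y" if "\<And>z. bracket x z = bracket y z" for x y
    using central_imp_zero[of "x - y"] that by (simp add: bracket_diff_left)
  have \<psi>': "bracket (\<psi> w) z = \<phi> (bracket w z) - bracket w (\<phi> z)" for w z
    by (simp add: \<psi>)
  have "derivation \<psi>"
    unfolding derivation_def
  proof (intro conjI allI)
    show "endo \<psi>"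
      by (rule endoI; rule eqI) (simp_all add: \<psi>' bracket_add_left bracket_scale_left
          endo_add[OF E] endo_scale[OF E] scale_right_diff_distrib)
    show "\<psi> (bracket x y) = bracket (\<psi> x) y + bracket x (\<psi> y)" for x y
      by (rule eqI, simp only: bracket_add_left bracket_bracket)
        (simp add: \<psi>' bracket_bracket endo_diff[OF E] bracket_diff_right)
  qed
  then obtain w where w: "\<psi> = bracket w"
    by (rule derivation_inner)
  define \<chi> where "\<chi> z = \<phi> z - bracket w z" for z
  have \<chi>: "\<chi> (bracket x z) = bracket x (\<chi> z)" for x z
    by (simp add: \<chi>_def \<psi> w bracket_bracket bracket_diff_right)
  have \<chi>': "\<chi> (bracket x z) = bracket (\<chi> x) z" for x z
  proof -
    have "\<chi> (bracket x z) = \<chi> (- bracket z x)"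
      by (simp add: bracket_antisym[of x z])
    also have "\<dots> = - \<chi> (bracket z x)"
      by (simp add: \<chi>_def endo_minus[OF E] bracket_minus_right)
    also have "\<dots> = bracket (\<chi> x) z"
      by (simp add: \<chi> bracket_antisym[of "\<chi> x" z])
    finally show ?thesis .
  qed
  let ?K = "{x. \<chi> x = 0}"
  have "?K = UNIV"
  proof (rule subspace_all_nested_brackets[of _ N])
    show "subspace ?K"
      unfolding \<chi>_def by (intro subspace_kernel_endo endo_sub E endo_bracket)
    fix xs :: "'a list" assume xs: "length xs = N"
    then have "xs \<noteq> []"
      using N(2) by auto
    \<comment> \<open>Both expressions equal \<open>\<phi> (nested_bracket xs)\<close>: one applies
      \<open>\<phi> = \<chi> + ad w\<close> to the bracket as a whole, the other uses the identity
      slot by slot. The difference is \<open>(N - 1) \<chi>\<close>.\<close>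
    have "\<chi> (nested_bracket xs) + bracket w (nested_bracket xs) = nested_sum \<phi> xs"
      using N(1) xs by (simp add: N_derivation_nested_sum \<chi>_def)
    also have "\<dots> = scale (of_nat N) (\<chi> (nested_bracket xs)) + bracket w (nested_bracket xs)"
      using nested_sum_centroid_plus_ad[of \<phi> \<chi> w xs] \<chi> \<chi>' \<open>xs \<noteq> []\<close> xs by (simp add: \<chi>_def)
    finally have "scale (of_nat N - 1) (\<chi> (nested_bracket xs)) = 0"
      by (simp add: scale_left_diff_distrib)
    moreover have "of_nat N - 1 \<noteq> (0 :: complex)"
      using N(2) by auto
    ultimately show "nested_bracket xs \<in> ?K"
      by simp
  qed (use N(2) in auto)
  then have "\<phi> = bracket w"
    by (auto simp: \<chi>_def fun_eq_iff)
  then show ?thesis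
    by (rule that)
qed

end

theorem mainTheorem6:
  fixes scale :: "complex \<Rightarrow> 'a::ab_group_add \<Rightarrow> 'a"
    and bracket :: "'a \<Rightarrow> 'a \<Rightarrow> 'a"
    and N :: nat and \<phi> :: "'a \<Rightarrow> 'a"
  assumes "lie_algebra scale bracket"
    and "\<exists>B. finite_dimensional_vector_space scale B"
    and "lie_algebra.semisimple scale bracket"
    and "N \<ge> 3"
    and "lie_algebra.N_derivation scale bracket N \<phi>"
  shows "\<exists>x. \<phi> = lie_algebra.ad bracket x"
proof -
  obtain B where B: "finite_dimensional_vector_space scale B"
    using assms(2) by blast
  interpret lie_algebra scale bracket
    by (rule assms(1))
  interpret finite_dimensional_vector_space scale B
    by (rule B)
  interpret complex_semisimple scale bracket B
    by unfold_locales (rule assms(3))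
  obtain x where "\<phi> = bracket x"
    using N_derivation_inner[OF assms(5)] assms(4) by auto
  then have "\<phi> = ad x"
    by (simp add: ad_def)
  then show ?thesis
    by blast
qed

end
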